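(* Let $\mathbf{T}=(T_1,\dots,T_n)$ be a commuting $n$-tuple of bounded linear operators on a Hilbert space $\mathcal{H}$, and let $(X,\mathbf{U})$ be a minimal unitary intertwining pair of $\mathbf{T}$. If the Lower Orbit Condition (LOC) holds for $(X,\mathbf{U})$ with bound-control $\kappa$, then $(X,\mathbf{U})$ is a unitary asymptote of $\mathbf{T}$ with norm-control $\kappa$.
   Context: Let $n\in\mathbb{N}$. Hilbert spaces are complex and may be $\{0\}$; $\mathcal{H}$ is separable; operators and transformations are bounded and linear. For commuting $n$-tuples $\mathbf{T}=(T_1,\dots,T_n)$ on $\mathcal{H}$ and $\widetilde{\mathbf{T}}=(\widetilde T_1,\dots,\widetilde T_n)$ on $\widetilde{\mathcal{H}}$, the intertwining set $\mathcal{I}(\mathbf{T},\widetilde{\mathbf{T}})$ consists of all bounded linear $X\colon\mathcal{H}\to\widetilde{\mathcal{H}}$ with $XT_i=\widetilde T_iX$ for $1\le i\le n$. A unitary intertwining pair of $\mathbf{T}$ is a pair $(X,\mathbf{U})$, where $\mathbf{U}=(U_1,\dots,U_n)$ is a commuting $n$-tuple of unitary operators on some Hilbert space $\mathcal{K}$ and $X\in\mathcal{I}(\mathbf{T},\mathbf{U})$. It is minimal if $\bigvee\{\mathbf{U}^{\mathbf{k}}X\mathcal{H}:\mathbf{k}\in\mathbb{Z}^n\}=\mathcal{K}$ (closed linear span), where $\mathbf{U}^{\mathbf{k}}=U_1^{k_1}\cdots U_n^{k_n}$. It is a unitary asymptote of $\mathbf{T}$ if for every unitary intertwining pair $(X',\mathbf{U}')$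 of $\mathbf{T}$ there exists a unique $Y'\in\mathcal{I}(\mathbf{U},\mathbf{U}')$ with $X'=Y'X$. A unitary asymptote $(X,\mathbf{U})$ has norm-control (with) $\kappa\in[0,\infty)$ if $\|Y'\|\le\kappa\|Y'X\|$ for every unitary intertwining pair $(Y',\mathbf{U}')$ of $\mathbf{U}$. The orbit-infimum of $\mathbf{T}$ at $h\in\mathcal{H}$ is $\text{o-inf}(\mathbf{T},h)=\inf\{\|\mathbf{T}^{\mathbf{k}}h\|:\mathbf{k}\in\mathbb{Z}_+^n\}$, where $\mathbb{Z}_+$ is the set of non-negative integers. (LOC) with bound-control $\kappa\in[0,\infty)$ holds for $(X,\mathbf{U})$ if $\text{o-inf}(\mathbf{T},h)\le\kappa\|Xh\|$ for all $h\in\mathcal{H}$. *)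

theory Defs
  imports "HOL-Analysis.Analysis"
begin

text \<open>
  Complex Hilbert spaces are types of class \<open>complex_hilbert\<close>.  A type with the
  single element \<open>0\<close> is allowed, so the zero space is included.  The inner product is linear in its
  first argument.  Since \<open>real_normed_vector\<close> is a superclass, the library's \<open>norm\<close>, topology,
  \<open>bounded_linear\<close> and \<open>onorm\<close> apply; \<open>cinner_self\<close> says that the norm is the one induced by the
  inner product.
\<close>

class complex_inner = real_normed_vector +
  fixes scaleC :: "complex \<Rightarrow> 'a \<Rightarrow> 'a"
    and cinner :: "'a \<Rightarrow> 'a \<Rightarrow> complex"
  assumes scaleC_add_right: "scaleC c (x + y) = scaleC c x + scaleC c y"
    and scaleC_add_left: "scaleC (c + d) x = scaleC c x + scaleC d x"
    and scaleC_scaleC: "scaleC c (scaleC d x) = scaleC (c * d) x"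
    and scaleC_of_real: "scaleC (complex_of_real r) x = r *\<^sub>R x"
    and cinner_commute: "cinner x y = cnj (cinner y x)"
    and cinner_add_left: "cinner (x + y) z = cinner x z + cinner y z"
    and cinner_scaleC_left: "cinner (scaleC c x) y = c * cinner x y"
    and cinner_self: "cinner x x = complex_of_real ((norm x)\<^sup>2)"

class complex_hilbert = complex_inner + complete_space

instantiation complex :: complex_hilbert
begin

definition scaleC_complex :: "complex \<Rightarrow> complex \<Rightarrow> complex"
  where "scaleC_complex c x = c * x"

definition cinner_complex :: "complex \<Rightarrow> complex \<Rightarrow> complex"
  where "cinner_complex x y = x * cnj y"

instance
  by standard
    (simp_all add: scaleC_complex_def cinner_complex_def algebra_simps scaleR_conv_of_real
      complex_norm_square[symmetric] del: of_real_power)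

end

lemma scaleC_one: "scaleC 1 x = (x :: 'a :: complex_inner)"
  using scaleC_of_real[of 1 x] by simp

global_interpretation complex_vector:
  vector_space "scaleC :: complex \<Rightarrow> 'a \<Rightarrow> 'a :: complex_inner"
  by standard (simp_all add: scaleC_add_right scaleC_add_left scaleC_scaleC scaleC_one)

definition bounded_clinear :: "('a :: complex_inner \<Rightarrow> 'b :: complex_inner) \<Rightarrow> bool"
  where "bounded_clinear f \<longleftrightarrow>
    bounded_linear f \<and> (\<forall>c x. f (scaleC c x) = scaleC c (f x))"

definition unitary_operator :: "('a :: complex_inner \<Rightarrow> 'a) \<Rightarrow> bool"
  where "unitary_operator U \<longleftrightarrow>
    bounded_clinear U \<and> surj U \<and> (\<forall>x y. cinner (U x) (U y) = cinner x y)"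

text \<open>
  An \<open>n\<close>-tuple of operators is a function on \<open>nat\<close> of which only the values at \<open>1, \<dots>, n\<close> matter.
\<close>

definition commuting_tuple :: "nat \<Rightarrow> (nat \<Rightarrow> 'a :: complex_inner \<Rightarrow> 'a) \<Rightarrow> bool"
  where "commuting_tuple n T \<longleftrightarrow>
    (\<forall>i\<in>{1..n}. bounded_clinear (T i)) \<and>
    (\<forall>i\<in>{1..n}. \<forall>j\<in>{1..n}. T i \<circ> T j = T j \<circ> T i)"

text \<open>The composition \<open>F 1 \<circ> \<dots> \<circ> F n\<close>.\<close>

definition comp_tuple :: "nat \<Rightarrow> (nat \<Rightarrow> 'a \<Rightarrow> 'a) \<Rightarrow> 'a \<Rightarrow> 'a"
  where "comp_tuple n F = foldr (\<lambda>i g. F i \<circ> g) [1..<Suc n] id"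

definition tuple_pow :: "nat \<Rightarrow> (nat \<Rightarrow> 'a \<Rightarrow> 'a) \<Rightarrow> (nat \<Rightarrow> nat) \<Rightarrow> 'a \<Rightarrow> 'a"
  where "tuple_pow n T k = comp_tuple n (\<lambda>i. T i ^^ k i)"

text \<open>Integer powers; only meaningful for bijective maps.\<close>

definition int_pow_map :: "('a \<Rightarrow> 'a) \<Rightarrow> int \<Rightarrow> 'a \<Rightarrow> 'a"
  where "int_pow_map U k = (if 0 \<le> k then U ^^ nat k else inv U ^^ nat (- k))"

definition tuple_int_pow :: "nat \<Rightarrow> (nat \<Rightarrow> 'a \<Rightarrow> 'a) \<Rightarrow> (nat \<Rightarrow> int) \<Rightarrow> 'a \<Rightarrow> 'a"
  where "tuple_int_pow n U k = comp_tuple n (\<lambda>i. int_pow_map (U i) (k i))"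

definition intertwiners ::
    "nat \<Rightarrow> (nat \<Rightarrow> 'a :: complex_inner \<Rightarrow> 'a) \<Rightarrow> (nat \<Rightarrow> 'b :: complex_inner \<Rightarrow> 'b) \<Rightarrow> ('a \<Rightarrow> 'b) set"
  where "intertwiners n T T' =
    {X. bounded_clinear X \<and> (\<forall>i\<in>{1..n}. X \<circ> T i = T' i \<circ> X)}"

definition unitary_intertwining_pair ::
    "nat \<Rightarrow> (nat \<Rightarrow> 'a :: complex_hilbert \<Rightarrow> 'a) \<Rightarrow>
      ('a \<Rightarrow> 'b) \<Rightarrow> (nat \<Rightarrow> 'b :: complex_hilbert \<Rightarrow> 'b) \<Rightarrow> bool"
  where "unitary_intertwining_pair n T X U \<longleftrightarrow>
    commuting_tuple n U \<and> (\<forall>i\<in>{1..n}. unitary_operator (U i)) \<and> X \<in> intertwiners n T U"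

definition minimal_pair ::
    "nat \<Rightarrow> ('a :: complex_hilbert \<Rightarrow> 'b) \<Rightarrow> (nat \<Rightarrow> 'b :: complex_hilbert \<Rightarrow> 'b) \<Rightarrow> bool"
  where "minimal_pair n X U \<longleftrightarrow>
    closure (complex_vector.span (\<Union>k. tuple_int_pow n U k ` range X)) = UNIV"

text \<open>
  HOL cannot quantify over types inside a formula.  In the next two definitions the space of the
  competing unitary pair is therefore the type argument \<open>'c\<close>; the notions are obtained by letting
  that type range over all Hilbert spaces, i.e. by leaving it a free type variable in the conclusion
  of a theorem.
\<close>

definition unitary_asymptote ::
    "'c :: complex_hilbert itself \<Rightarrow> nat \<Rightarrow> (nat \<Rightarrow> 'a :: complex_hilbert \<Rightarrow> 'a) \<Rightarrow>
      ('a \<Rightarrow> 'b) \<Rightarrow> (nat \<Rightarrow> 'b :: complex_hilbert \<Rightarrow> 'b) \<Rightarrow> bool"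
  where "unitary_asymptote _ n T X U \<longleftrightarrow>
    unitary_intertwining_pair n T X U \<and>
    (\<forall>(X' :: 'a \<Rightarrow> 'c) U'. unitary_intertwining_pair n T X' U' \<longrightarrow>
      (\<exists>!Y'. Y' \<in> intertwiners n U U' \<and> X' = Y' \<circ> X))"

definition norm_control ::
    "'c :: complex_hilbert itself \<Rightarrow> nat \<Rightarrow>
      ('a :: complex_hilbert \<Rightarrow> 'b) \<Rightarrow> (nat \<Rightarrow> 'b :: complex_hilbert \<Rightarrow> 'b) \<Rightarrow> real \<Rightarrow> bool"
  where "norm_control _ n X U \<kappa> \<longleftrightarrow>
    0 \<le> \<kappa> \<and>
    (\<forall>(Y' :: 'b \<Rightarrow> 'c) U'. unitary_intertwining_pair n U Y' U' \<longrightarrow>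
      onorm Y' \<le> \<kappa> * onorm (Y' \<circ> X))"

definition orbit_inf :: "nat \<Rightarrow> (nat \<Rightarrow> 'a :: complex_hilbert \<Rightarrow> 'a) \<Rightarrow> 'a \<Rightarrow> real"
  where "orbit_inf n T h = (INF k. norm (tuple_pow n T k h))"

definition lower_orbit_condition ::
    "nat \<Rightarrow> (nat \<Rightarrow> 'a :: complex_hilbert \<Rightarrow> 'a) \<Rightarrow> ('a \<Rightarrow> 'b :: complex_hilbert) \<Rightarrow> real \<Rightarrow> bool"
  where "lower_orbit_condition n T X \<kappa> \<longleftrightarrow>
    0 \<le> \<kappa> \<and> (\<forall>h. orbit_inf n T h \<le> \<kappa> * norm (X h))"

end

theory Submission
  imports Defs
begin

text \<open>
  If \<open>(X', U')\<close> is another unitary intertwining pair of \<open>T\<close>, then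
  \<open>\<parallel>X' h\<parallel> = \<parallel>U'\<^sup>k X' h\<parallel> = \<parallel>X' T\<^sup>k h\<parallel> \<le> \<parallel>X'\<parallel> \<parallel>T\<^sup>k h\<parallel>\<close> for every \<open>k\<close>, so (LOC) gives
  \<open>\<parallel>X' h\<parallel> \<le> \<kappa> \<parallel>X'\<parallel> \<parallel>X h\<parallel>\<close>.  The vectors \<open>y\<close> such that \<open>U\<^sup>m y = X h\<close> for some \<open>m \<ge> 0\<close> and some \<open>h\<close> form
  a subspace, which is dense by minimality.  An intertwiner \<open>Y\<close> with \<open>Y X = X'\<close> must send such a \<open>y\<close>
  to the unique \<open>z\<close> with \<open>U'\<^sup>m z = X' h\<close>, and \<open>\<parallel>z\<parallel> = \<parallel>X' h\<parallel> \<le> \<kappa> \<parallel>X'\<parallel> \<parallel>y\<parallel>\<close>.  So \<open>Y\<close> exists by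
  continuous extension, is unique, and satisfies \<open>\<parallel>Y\<parallel> \<le> \<kappa> \<parallel>X'\<parallel>\<close>.
\<close>

section \<open>Bounded complex-linear maps\<close>

text \<open>Conjugate symmetry turns linearity in the first argument into conjugate linearity in the
  second, so pulling \<open>c\<close> out of both slots leaves \<open>c * cnj c\<close>. The class
  itself only gives homogeneity for real scalars.\<close>

lemma norm_scaleC: "norm (scaleC c x) = cmod c * norm (x :: 'a :: complex_inner)"
proof -
  have "cinner (scaleC c x) (scaleC c x) = c * cnj (cinner (scaleC c x) x)"
    by (metis cinner_commute cinner_scaleC_left)
  also have "\<dots> = (c * cnj c) * cnj (cinner x x)"
    by (simp add: cinner_scaleC_left)
  also have "\<dots> = complex_of_real ((cmod c * norm x)\<^sup>2)"
    unfolding cinner_self complex_norm_square[symmetric] power_mult_distrib by simp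
  finally have "(norm (scaleC c x))\<^sup>2 = (cmod c * norm x)\<^sup>2"
    unfolding cinner_self of_real_eq_iff .
  then show ?thesis
    by (simp add: power2_eq_iff_nonneg)
qed

lemma scaleC_minus_one: "scaleC (-1) x = - (x :: 'a :: complex_inner)"
  using scaleC_of_real[of "-1" x] by simp

lemma bounded_clinearI:
  assumes "\<And>x y. f (x + y) = f x + f y"
    and "\<And>c x. f (scaleC c x) = scaleC c (f x)"
    and "\<And>x. norm (f x) \<le> C * norm x"
  shows "bounded_clinear f"
  unfolding bounded_clinear_def
proof
  show "bounded_linear f"
  proof (rule bounded_linear_intro)
    show "f (r *\<^sub>R x) = r *\<^sub>R f x" for r x
      using assms(2)[of "complex_of_real r" x] by (simp only: scaleC_of_real)
    show "norm (f x) \<le> norm x * C" for x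
      using assms(3)[of x] by (simp add: mult.commute)
  qed (fact assms(1))
qed (simp add: assms(2))

lemma bounded_clinear_add: "bounded_clinear f \<Longrightarrow> f (x + y) = f x + f y"
  by (simp add: bounded_clinear_def bounded_linear.linear linear_add)

lemma bounded_clinear_scaleC: "bounded_clinear f \<Longrightarrow> f (scaleC c x) = scaleC c (f x)"
  by (simp add: bounded_clinear_def)

lemma bounded_clinear_continuous_on: "bounded_clinear f \<Longrightarrow> continuous_on S f"
  by (simp add: bounded_clinear_def linear_continuous_on)

lemma bounded_clinear_id: "bounded_clinear id"
  by (rule bounded_clinearI[where C = 1]) auto

lemma bounded_clinear_comp:
  "bounded_clinear f \<Longrightarrow> bounded_clinear g \<Longrightarrow> bounded_clinear (f \<circ> g)"
  by (simp add: bounded_clinear_def bounded_linear_compose o_def)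

lemma continuous_on_scaleC: "continuous_on S (scaleC c)"
  by (rule bounded_clinear_continuous_on, rule bounded_clinearI[where C = "cmod c"])
     (simp_all add: scaleC_add_right scaleC_scaleC mult.commute norm_scaleC)

section \<open>Density arguments and continuous extension\<close>

lemma continuous_eq_on_dense:
  fixes f g :: "'a :: topological_space \<Rightarrow> 'b :: t2_space"
  assumes "closure D = UNIV" "continuous_on UNIV f" "continuous_on UNIV g"
    and "\<And>x. x \<in> D \<Longrightarrow> f x = g x"
  shows "f x = g x"
proof -
  have "closure D \<subseteq> {x. f x = g x}"
    by (rule closure_minimal) (use assms in \<open>auto intro: closed_Collect_eq\<close>)
  with assms(1) show ?thesis by blast
qed

lemma norm_bound_on_dense:
  fixes f :: "'a :: real_normed_vector \<Rightarrow> 'b :: real_normed_vector"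
  assumes "closure D = UNIV" "continuous_on UNIV f"
    and "\<And>x. x \<in> D \<Longrightarrow> norm (f x) \<le> C * norm x"
  shows "norm (f x) \<le> C * norm x"
proof -
  have "closure D \<subseteq> {x. norm (f x) \<le> C * norm x}"
    by (rule closure_minimal)
       (use assms in \<open>auto intro!: closed_Collect_le continuous_intros\<close>)
  with assms(1) show ?thesis by blast
qed

text \<open>By linearity the bound makes \<open>f\<close> Lipschitz, hence uniformly continuous, on
  \<open>D\<close>, and completeness of the target gives a continuous extension. Linearity and the
  bound then pass from \<open>D\<close> to its closure.\<close>

lemma bounded_clinear_extension:
  fixes f :: "'a :: complex_inner \<Rightarrow> 'b :: complex_hilbert"
  assumes dense: "closure D = UNIV"
    and D_add: "\<And>x y. x \<in> D \<Longrightarrow> y \<in> D \<Longrightarrow> x + y \<in> D"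
    and D_scaleC: "\<And>c x. x \<in> D \<Longrightarrow> scaleC c x \<in> D"
    and f_add: "\<And>x y. x \<in> D \<Longrightarrow> y \<in> D \<Longrightarrow> f (x + y) = f x + f y"
    and f_scaleC: "\<And>c x. x \<in> D \<Longrightarrow> f (scaleC c x) = scaleC c (f x)"
    and f_bound: "\<And>x. x \<in> D \<Longrightarrow> norm (f x) \<le> C * norm x"
  obtains g where "bounded_clinear g" "\<And>x. x \<in> D \<Longrightarrow> g x = f x"
proof -
  have D_diff: "x - y \<in> D" "f (x - y) = f x - f y" if "x \<in> D" "y \<in> D" for x y
  proof -
    have "- y \<in> D" "f (- y) = - f y"
      using that D_scaleC[of y "-1"] f_scaleC[of y "-1"] by (simp_all only: scaleC_minus_one)
    with that D_add[of x "- y"] f_add[of x "- y"] show "x - y \<in> D" "f (x - y) = f x - f y"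
      by simp_all
  qed
  \<comment> \<open>A Lipschitz constant must be nonnegative, while \<open>C\<close> carries no sign
    assumption.\<close>
  have "(\<bar>C\<bar>)-lipschitz_on D f"
  proof (rule lipschitz_onI)
    fix x y assume "x \<in> D" "y \<in> D"
    then have "dist (f x) (f y) \<le> C * dist x y"
      using f_bound[of "x - y"] D_diff[of x y] by (simp add: dist_norm)
    also have "\<dots> \<le> \<bar>C\<bar> * dist x y"
      by (intro mult_right_mono) auto
    finally show "dist (f x) (f y) \<le> \<bar>C\<bar> * dist x y" .
  qed simp
  then have "uniformly_continuous_on D f"
    by (rule lipschitz_on_uniformly_continuous)
  then obtain g where g: "uniformly_continuous_on (closure D) g" "\<And>x. x \<in> D \<Longrightarrow> f x = g x"
    by (rule uniformly_continuous_on_extension_on_closure) blast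
  have cont: "continuous_on S g" for S
    using uniformly_continuous_imp_continuous[OF g(1)] continuous_on_subset
    by (auto simp: dense)
  have cont_comp: "continuous_on UNIV (\<lambda>x. g (k x))" if "continuous_on UNIV k" for k
    using continuous_on_compose[OF that cont] by (simp add: o_def)
  \<comment> \<open>Density is applied to one variable at a time: here to \<open>y\<close> with
    \<open>x\<close> in \<open>D\<close>, then to \<open>x\<close> with \<open>y\<close>
    arbitrary.\<close>
  have add_D: "g (x + y) = g x + g y" if "x \<in> D" for x y
  proof (rule continuous_eq_on_dense[OF dense, where x = y])
    show "g (x + v) = g x + g v" if "v \<in> D" for v
      using \<open>x \<in> D\<close> that by (metis D_add f_add g(2))
  qed (intro continuous_intros cont cont_comp)+
  have add: "g (x + y) = g x + g y" for x y
    by (rule continuous_eq_on_dense[OF dense, where x = x])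
       (intro continuous_intros cont cont_comp add_D | assumption)+
  have scale: "g (scaleC c x) = scaleC c (g x)" for c x
  proof (rule continuous_eq_on_dense[OF dense, where x = x])
    show "continuous_on UNIV (\<lambda>x. scaleC c (g x))"
      using continuous_on_compose[OF cont continuous_on_scaleC] by (simp add: o_def)
    show "g (scaleC c v) = scaleC c (g v)" if "v \<in> D" for v
      using that by (metis D_scaleC f_scaleC g(2))
  qed (intro cont_comp continuous_on_scaleC)
  have bound: "norm (g x) \<le> C * norm x" for x
    by (rule norm_bound_on_dense[OF dense cont]) (metis f_bound g(2))
  show ?thesis
    by (rule that[of g]) (auto intro: bounded_clinearI add scale bound simp: g(2))
qed

section \<open>Unitary operators\<close>

lemma norm_unitary: "unitary_operator U \<Longrightarrow> norm (U x) = norm x"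
  unfolding unitary_operator_def
  by (metis cinner_self norm_ge_zero of_real_eq_iff power2_eq_iff_nonneg)

lemma bij_unitary: "unitary_operator U \<Longrightarrow> bij U"
proof -
  assume U: "unitary_operator U"
  have "inj U"
  proof (rule injI)
    fix x y assume "U x = U y"
    moreover have "norm (U (x - y)) = norm (U x - U y)"
      using U by (simp add: unitary_operator_def bounded_clinear_def linear_diff bounded_linear.linear)
    ultimately show "x = y" using norm_unitary[OF U, of "x - y"] by simp
  qed
  with U show "bij U" by (simp add: unitary_operator_def bij_def)
qed

section \<open>Powers of tuples\<close>

lemma comp_tuple_0: "comp_tuple 0 F = id"
  by (simp add: comp_tuple_def)

lemma comp_tuple_Suc: "comp_tuple (Suc n) F = comp_tuple n F \<circ> F (Suc n)"
proof -
  \<comment> \<open>\<open>foldr\<close> peels off the first factor, but induction on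
    \<open>n\<close> needs the last one. Generalizing the starting value from \<open>id\<close> to
    \<open>h\<close> lets \<open>F (Suc n)\<close> be that value.\<close>
  have "foldr (\<lambda>i g. F i \<circ> g) xs h = foldr (\<lambda>i g. F i \<circ> g) xs id \<circ> h" for xs h
    by (induction xs) (auto simp: o_assoc)
  from this[of "[1..<Suc n]" "F (Suc n)"] show ?thesis by (simp add: comp_tuple_def)
qed

lemma comp_tuple_closed:
  assumes "P id" "\<And>f g. P f \<Longrightarrow> P g \<Longrightarrow> P (f \<circ> g)" "\<And>i. i \<in> {1..n} \<Longrightarrow> P (F i)"
  shows "P (comp_tuple n F)"
  using assms(3) by (induction n) (simp_all add: comp_tuple_0 comp_tuple_Suc assms(1,2))

lemma comp_tuple_cong:
  "(\<And>i. i \<in> {1..n} \<Longrightarrow> F i = G i) \<Longrightarrow> comp_tuple n F = comp_tuple n G"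
  by (induction n) (simp_all add: comp_tuple_0 comp_tuple_Suc)

lemma comp_tuple_intertwine:
  assumes "\<And>i. i \<in> {1..n} \<Longrightarrow> X \<circ> F i = G i \<circ> X"
  shows "X \<circ> comp_tuple n F = comp_tuple n G \<circ> X"
  using assms
proof (induction n)
  case (Suc n)
  have "X \<circ> comp_tuple n F = comp_tuple n G \<circ> X"
    by (rule Suc.IH, rule Suc.prems) simp
  moreover have "X \<circ> F (Suc n) = G (Suc n) \<circ> X"
    by (rule Suc.prems) simp
  ultimately show ?case
    unfolding comp_tuple_Suc by (metis comp_assoc)
qed (simp add: comp_tuple_0)

text \<open>\<open>F (Suc n)\<close> slides past \<open>comp_tuple n G\<close>, after which the two
  last factors stand next to each other and the induction hypothesis handles the rest.\<close>

lemma comp_tuple_comp: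
  assumes "\<And>i j. i \<in> {1..n} \<Longrightarrow> j \<in> {1..n} \<Longrightarrow> F i \<circ> G j = G j \<circ> F i"
  shows "comp_tuple n F \<circ> comp_tuple n G = comp_tuple n (\<lambda>i. F i \<circ> G i)"
  using assms
proof (induction n)
  case (Suc n)
  have "F (Suc n) \<circ> comp_tuple n G = comp_tuple n G \<circ> F (Suc n)"
    by (rule comp_tuple_intertwine, rule Suc.prems) simp_all
  then have "comp_tuple (Suc n) F \<circ> comp_tuple (Suc n) G
      = (comp_tuple n F \<circ> comp_tuple n G) \<circ> (F (Suc n) \<circ> G (Suc n))"
    by (metis comp_tuple_Suc comp_assoc)
  moreover have "comp_tuple n F \<circ> comp_tuple n G = comp_tuple n (\<lambda>i. F i \<circ> G i)"
    by (rule Suc.IH, rule Suc.prems) simp_all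
  ultimately show ?case by (simp only: comp_tuple_Suc)
qed (simp add: comp_tuple_0)

lemma funpow_intertwine: "X \<circ> f = g \<circ> X \<Longrightarrow> X \<circ> f ^^ k = g ^^ k \<circ> X"
proof (induction k)
  case (Suc k)
  then show ?case by (metis comp_assoc funpow.simps(2))
qed simp

lemma tuple_pow_closed:
  assumes "P id" "\<And>f g. P f \<Longrightarrow> P g \<Longrightarrow> P (f \<circ> g)" "\<And>i. i \<in> {1..n} \<Longrightarrow> P (T i)"
  shows "P (tuple_pow n T k)"
  unfolding tuple_pow_def
proof (rule comp_tuple_closed[OF assms(1,2)])
  fix i assume "i \<in> {1..n}"
  then have "P (T i ^^ m)" for m
    by (induction m) (simp_all only: funpow.simps assms)
  then show "P (T i ^^ k i)" .
qed

lemma tuple_pow_0: "tuple_pow n T (\<lambda>i. 0) x = x"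
proof -
  have "comp_tuple n (\<lambda>i. id) x = x"
    by (rule comp_tuple_closed[where P = "\<lambda>f. f x = x"]) (simp_all add: id_def)
  then show ?thesis by (simp add: tuple_pow_def id_def)
qed

lemma tuple_pow_intertwine:
  assumes "\<And>i. i \<in> {1..n} \<Longrightarrow> X \<circ> T i = T' i \<circ> X"
  shows "X (tuple_pow n T k x) = tuple_pow n T' k (X x)"
proof -
  have "X \<circ> tuple_pow n T k = tuple_pow n T' k \<circ> X"
    unfolding tuple_pow_def by (intro comp_tuple_intertwine funpow_intertwine assms)
  then show ?thesis by (simp add: fun_eq_iff)
qed

lemma commuting_tupleD:
  "commuting_tuple n T \<Longrightarrow> i \<in> {1..n} \<Longrightarrow> j \<in> {1..n} \<Longrightarrow> T i \<circ> T j = T j \<circ> T i"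
  by (simp add: commuting_tuple_def)

lemma tuple_pow_add:
  assumes "commuting_tuple n T"
  shows "tuple_pow n T (\<lambda>i. k i + l i) x = tuple_pow n T k (tuple_pow n T l x)"
proof -
  have "tuple_pow n T k \<circ> tuple_pow n T l = comp_tuple n (\<lambda>i. T i ^^ k i \<circ> T i ^^ l i)"
    unfolding tuple_pow_def
    by (intro comp_tuple_comp funpow_intertwine funpow_intertwine[symmetric]
        commuting_tupleD[OF assms])
  then show ?thesis by (simp add: tuple_pow_def funpow_add fun_eq_iff)
qed

lemma bounded_clinear_tuple_pow:
  "commuting_tuple n T \<Longrightarrow> bounded_clinear (tuple_pow n T k)"
  by (rule tuple_pow_closed)
     (simp_all only: commuting_tuple_def bounded_clinear_id bounded_clinear_comp)

lemma norm_tuple_pow_unitary: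
  "(\<And>i. i \<in> {1..n} \<Longrightarrow> unitary_operator (U i)) \<Longrightarrow> norm (tuple_pow n U k x) = norm x"
  using tuple_pow_closed[where P = "\<lambda>f. \<forall>x. norm (f x) = norm x" and n = n and T = U and k = k]
  by (auto simp: norm_unitary)

lemma surj_tuple_pow_unitary:
  "(\<And>i. i \<in> {1..n} \<Longrightarrow> unitary_operator (U i)) \<Longrightarrow> surj (tuple_pow n U k)"
  by (rule tuple_pow_closed) (simp_all only: unitary_operator_def comp_surj surj_id)

section \<open>Integer powers and clearing of negative exponents\<close>

lemma int_pow_map_commute:
  assumes "bij U" "f \<circ> U = U \<circ> f"
  shows "f \<circ> int_pow_map U k = int_pow_map U k \<circ> f"
proof -
  have "f \<circ> inv U = inv U \<circ> f"
  proof
    fix x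
    have "U (f (inv U x)) = f x"
      using assms by (metis bij_inv_eq_iff comp_apply)
    then show "(f \<circ> inv U) x = (inv U \<circ> f) x"
      using assms(1) by (metis bij_inv_eq_iff comp_apply)
  qed
  with assms(2) show ?thesis
    by (simp add: int_pow_map_def funpow_intertwine)
qed

text \<open>Here \<open>nat k\<close> and \<open>nat (- k)\<close> are the positive and negative
  parts of \<open>k\<close>; multiplying by the negative part cancels every inverse.\<close>

lemma funpow_int_pow_map:
  assumes "bij U"
  shows "U ^^ nat (- k) \<circ> int_pow_map U k = U ^^ nat k"
proof (cases "0 \<le> k")
  case False
  have "U ^^ m \<circ> inv U ^^ m = id" for m
    using assms by (simp add: fun_eq_iff fn_o_inv_fn_is_id)
  with False show ?thesis by (simp add: int_pow_map_def)
qed (simp add: int_pow_map_def)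

lemma tuple_pow_tuple_int_pow:
  assumes "commuting_tuple n U" "\<And>i. i \<in> {1..n} \<Longrightarrow> bij (U i)"
  shows "tuple_pow n U (\<lambda>i. nat (- k i)) (tuple_int_pow n U k x) = tuple_pow n U (\<lambda>i. nat (k i)) x"
proof -
  have "tuple_pow n U (\<lambda>i. nat (- k i)) \<circ> tuple_int_pow n U k
      = comp_tuple n (\<lambda>i. U i ^^ nat (- k i) \<circ> int_pow_map (U i) (k i))"
    unfolding tuple_pow_def tuple_int_pow_def
    by (intro comp_tuple_comp int_pow_map_commute assms(2) funpow_intertwine[symmetric]
        commuting_tupleD[OF assms(1)])
  also have "\<dots> = tuple_pow n U (\<lambda>i. nat (k i))"
    unfolding tuple_pow_def by (intro comp_tuple_cong funpow_int_pow_map assms(2))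
  finally show ?thesis by (simp add: fun_eq_iff)
qed

section \<open>Comparison of unitary intertwining pairs\<close>

lemma unitary_intertwining_pairD:
  assumes "unitary_intertwining_pair n T X U"
  shows "commuting_tuple n U" "\<And>i. i \<in> {1..n} \<Longrightarrow> unitary_operator (U i)"
    "bounded_clinear X" "\<And>i. i \<in> {1..n} \<Longrightarrow> X \<circ> T i = U i \<circ> X"
  using assms by (auto simp: unitary_intertwining_pair_def intertwiners_def)

lemma unitary_intertwining_pair_tuple_pow:
  assumes "unitary_intertwining_pair n T X U"
  shows "X (tuple_pow n T k h) = tuple_pow n U k (X h)"
  by (rule tuple_pow_intertwine) (rule unitary_intertwining_pairD(4)[OF assms])

lemma unitary_intertwining_pair_norm:
  assumes "unitary_intertwining_pair n T X U"
  shows "norm (tuple_pow n U k y) = norm y"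
  by (rule norm_tuple_pow_unitary) (rule unitary_intertwining_pairD(2)[OF assms])

text \<open>Norm-control speaks of pairs of \<open>U\<close>; composing with \<open>X\<close> turns
  them into pairs of \<open>T\<close>, to which (LOC) applies.\<close>

lemma unitary_intertwining_pair_comp:
  assumes "unitary_intertwining_pair n T X U" "unitary_intertwining_pair n U Y U'"
  shows "unitary_intertwining_pair n T (Y \<circ> X) U'"
proof -
  have "Y \<circ> X \<circ> T i = U' i \<circ> (Y \<circ> X)" if "i \<in> {1..n}" for i
    using unitary_intertwining_pairD(4)[OF assms(1) that]
      unitary_intertwining_pairD(4)[OF assms(2) that] by (metis comp_assoc)
  with assms show ?thesis
    by (simp add: unitary_intertwining_pair_def intertwiners_def bounded_clinear_comp)
qed

text \<open>For unitary \<open>U\<close> this is the union of the spaces \<open>U^(-m)\<close>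
  applied to \<open>range X\<close>, written so that only nonnegative powers occur.\<close>

definition pullback_space ::
    "nat \<Rightarrow> ('a \<Rightarrow> 'b) \<Rightarrow> (nat \<Rightarrow> 'b \<Rightarrow> 'b) \<Rightarrow> 'b set"
  where "pullback_space n X U = {y. \<exists>m h. tuple_pow n U m y = X h}"

text \<open>The set is a subspace, and by clearing negative exponents it contains every generator
  \<open>U^k (X h)\<close>. So it contains the span that minimality makes dense.\<close>

lemma pullback_space_dense:
  assumes T: "commuting_tuple n T" and pair: "unitary_intertwining_pair n T X U"
    and minimal: "minimal_pair n X U"
  shows "closure (pullback_space n X U) = UNIV"
proof -
  note U = unitary_intertwining_pairD[OF pair]
  note lin = bounded_clinear_tuple_pow[OF U(1)]
  have "complex_vector.subspace (pullback_space n X U)"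
  proof (rule complex_vector.subspaceI)
    show "0 \<in> pullback_space n X U"
      using lin U(3) unfolding pullback_space_def bounded_clinear_def
      by (auto simp: linear_0 bounded_linear.linear intro!: exI[of _ 0])
  next
    fix x y assume "x \<in> pullback_space n X U" "y \<in> pullback_space n X U"
    then obtain k g l h where eq: "tuple_pow n U k x = X g" "tuple_pow n U l y = X h"
      by (auto simp: pullback_space_def)
    \<comment> \<open>Both exponents are raised to the common value \<open>k + l\<close>. The order
      of the summands makes \<open>tuple_pow_add\<close> leave the known power of \<open>x\<close>
      innermost.\<close>
    have "tuple_pow n U (\<lambda>i. l i + k i) x = X (tuple_pow n T l g)"
      by (simp add: tuple_pow_add[OF U(1)] eq unitary_intertwining_pair_tuple_pow[OF pair])
    moreover have "tuple_pow n U (\<lambda>i. k i + l i) y = X (tuple_pow n T k h)"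
      by (simp add: tuple_pow_add[OF U(1)] eq unitary_intertwining_pair_tuple_pow[OF pair])
    ultimately have "tuple_pow n U (\<lambda>i. k i + l i) (x + y) = X (tuple_pow n T l g + tuple_pow n T k h)"
      by (simp add: bounded_clinear_add lin U(3) add.commute)
    then show "x + y \<in> pullback_space n X U" unfolding pullback_space_def by blast
  next
    fix c x assume "x \<in> pullback_space n X U"
    then obtain k g where "tuple_pow n U k x = X g" by (auto simp: pullback_space_def)
    then have "tuple_pow n U k (scaleC c x) = X (scaleC c g)"
      by (simp add: bounded_clinear_scaleC lin U(3))
    then show "scaleC c x \<in> pullback_space n X U" unfolding pullback_space_def by blast
  qed
  moreover have "(\<Union>k. tuple_int_pow n U k ` range X) \<subseteq> pullback_space n X U"
  proof clarify
    fix k h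
    have "tuple_pow n U (\<lambda>i. nat (- k i)) (tuple_int_pow n U k (X h))
        = X (tuple_pow n T (\<lambda>i. nat (k i)) h)"
      unfolding unitary_intertwining_pair_tuple_pow[OF pair]
      by (rule tuple_pow_tuple_int_pow[OF U(1)]) (rule bij_unitary[OF U(2)])
    then show "tuple_int_pow n U k (X h) \<in> pullback_space n X U"
      unfolding pullback_space_def by blast
  qed
  ultimately have "complex_vector.span (\<Union>k. tuple_int_pow n U k ` range X) \<subseteq> pullback_space n X U"
    by (intro complex_vector.span_minimal)
  then show ?thesis
    using closure_mono minimal unfolding minimal_pair_def by blast
qed

text \<open>The graph of the only candidate for an intertwiner \<open>Y\<close> with \<open>Y \<circ> X = X'\<close>.\<close>

definition transfer_rel ::
    "nat \<Rightarrow> ('a \<Rightarrow> 'b) \<Rightarrow> (nat \<Rightarrow> 'b \<Rightarrow> 'b) \<Rightarrow> ('a \<Rightarrow> 'c) \<Rightarrow> (nat \<Rightarrow> 'c \<Rightarrow> 'c) \<Rightarrow> 'b \<Rightarrow> 'c \<Rightarrow> bool"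
  where "transfer_rel n X U X' U' y z \<longleftrightarrow>
    (\<exists>m h. tuple_pow n U m y = X h \<and> tuple_pow n U' m z = X' h)"

text \<open>(LOC) enters the comparison only through \<open>dominated\<close>, with \<open>C\<close>
  later taken as \<open>\<kappa> * onorm X'\<close>. For norm-control, \<open>X'\<close> will be
  \<open>Y' \<circ> X\<close>.\<close>

locale dominated_pair =
  fixes n :: nat and T :: "nat \<Rightarrow> 'h :: complex_hilbert \<Rightarrow> 'h"
    and X :: "'h \<Rightarrow> 'k :: complex_hilbert" and U :: "nat \<Rightarrow> 'k \<Rightarrow> 'k"
    and X' :: "'h \<Rightarrow> 'c :: complex_hilbert" and U' :: "nat \<Rightarrow> 'c \<Rightarrow> 'c" and C :: real
  assumes T: "commuting_tuple n T"
    and pair: "unitary_intertwining_pair n T X U"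
    and minimal: "minimal_pair n X U"
    and pair': "unitary_intertwining_pair n T X' U'"
    and dominated: "norm (X' h) \<le> C * norm (X h)"
begin

lemmas U = unitary_intertwining_pairD[OF pair]
lemmas U' = unitary_intertwining_pairD[OF pair']
lemmas lin = bounded_clinear_tuple_pow[OF U(1)]
lemmas lin' = bounded_clinear_tuple_pow[OF U'(1)]

abbreviation "D \<equiv> pullback_space n X U"
abbreviation "R \<equiv> transfer_rel n X U X' U'"

lemmas dense = pullback_space_dense[OF T pair minimal]

lemma R_imp_D: "R y z \<Longrightarrow> y \<in> D"
  by (auto simp: pullback_space_def transfer_rel_def)

text \<open>Surjectivity of the unitary powers provides the preimage of \<open>X' h\<close>.\<close>

lemma R_exists:
  assumes "y \<in> D" shows "\<exists>z. R y z"
proof -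
  from assms obtain m h where "tuple_pow n U m y = X h" by (auto simp: pullback_space_def)
  moreover obtain z where "X' h = tuple_pow n U' m z"
    by (rule surjE[OF surj_tuple_pow_unitary[OF U'(2)]])
  ultimately show ?thesis unfolding transfer_rel_def by metis
qed

lemma R_bound: "R y z \<Longrightarrow> norm z \<le> C * norm y"
  unfolding transfer_rel_def
  by (metis pair pair' dominated unitary_intertwining_pair_norm)

text \<open>The passage to a common exponent works on both sides with the same vector
  \<open>?h\<close>, because \<open>X\<close> and \<open>X'\<close> intertwine the same
  \<open>T\<close>.\<close>

lemma R_add:
  assumes "R x v" "R y w" shows "R (x + y) (v + w)"
proof -
  from assms obtain k g l h where
    eq: "tuple_pow n U k x = X g" "tuple_pow n U l y = X h"
      "tuple_pow n U' k v = X' g" "tuple_pow n U' l w = X' h"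
    by (auto simp: transfer_rel_def)
  let ?h = "tuple_pow n T l g + tuple_pow n T k h"
  have "tuple_pow n U (\<lambda>i. l i + k i) x = X (tuple_pow n T l g)"
    "tuple_pow n U (\<lambda>i. k i + l i) y = X (tuple_pow n T k h)"
    "tuple_pow n U' (\<lambda>i. l i + k i) v = X' (tuple_pow n T l g)"
    "tuple_pow n U' (\<lambda>i. k i + l i) w = X' (tuple_pow n T k h)"
    by (simp_all add: tuple_pow_add U(1) U'(1) eq
        unitary_intertwining_pair_tuple_pow[OF pair] unitary_intertwining_pair_tuple_pow[OF pair'])
  then have "tuple_pow n U (\<lambda>i. k i + l i) (x + y) = X ?h"
    "tuple_pow n U' (\<lambda>i. k i + l i) (v + w) = X' ?h"
    by (simp_all add: bounded_clinear_add lin lin' U(3) U'(3) add.commute)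
  then show ?thesis unfolding transfer_rel_def by blast
qed

lemma R_scaleC:
  assumes "R y z" shows "R (scaleC c y) (scaleC c z)"
proof -
  from assms obtain m h where "tuple_pow n U m y = X h" "tuple_pow n U' m z = X' h"
    by (auto simp: transfer_rel_def)
  then have "tuple_pow n U m (scaleC c y) = X (scaleC c h)"
    "tuple_pow n U' m (scaleC c z) = X' (scaleC c h)"
    by (simp_all add: bounded_clinear_scaleC lin lin' U(3) U'(3))
  then show ?thesis unfolding transfer_rel_def by blast
qed

text \<open>This is independence of the choice of \<open>m\<close> and \<open>h\<close>: by
  linearity \<open>R\<close> relates \<open>0\<close> to \<open>z - w\<close>, and
  \<open>R_bound\<close> forces that difference to vanish.\<close>

lemma R_unique: "R y z \<Longrightarrow> R y w \<Longrightarrow> z = w"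
proof -
  assume "R y z" "R y w"
  have "R (y + - y) (z + - w)"
    using R_add[OF \<open>R y z\<close> R_scaleC[OF \<open>R y w\<close>, of "-1"]] by (simp only: scaleC_minus_one)
  then show "z = w" using R_bound by fastforce
qed

lemma R_X: "R (X h) (X' h)"
  unfolding transfer_rel_def using tuple_pow_0 by metis

lemma R_U:
  assumes "R y z" "i \<in> {1..n}" shows "R (U i y) (U' i z)"
proof -
  from assms(1) obtain m h where eq: "tuple_pow n U m y = X h" "tuple_pow n U' m z = X' h"
    by (auto simp: transfer_rel_def)
  have "tuple_pow n U m (U i y) = U i (tuple_pow n U m y)"
    by (rule tuple_pow_intertwine[symmetric]) (rule commuting_tupleD[OF U(1) assms(2)])
  moreover have "tuple_pow n U' m (U' i z) = U' i (tuple_pow n U' m z)"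
    by (rule tuple_pow_intertwine[symmetric]) (rule commuting_tupleD[OF U'(1) assms(2)])
  ultimately have "tuple_pow n U m (U i y) = X (T i h)" "tuple_pow n U' m (U' i z) = X' (T i h)"
    using U(4)[OF assms(2)] U'(4)[OF assms(2)] by (simp_all add: eq fun_eq_iff)
  then show ?thesis unfolding transfer_rel_def by blast
qed

text \<open>On \<open>D\<close> the graph of any solution lies in \<open>R\<close>. Hence the bound
  and the uniqueness hold for arbitrary solutions, not just for the one constructed below.\<close>

lemma R_intertwiner:
  assumes "Y \<in> intertwiners n U U'" "X' = Y \<circ> X" "y \<in> D"
  shows "R y (Y y)"
proof -
  from assms(3) obtain m h where eq: "tuple_pow n U m y = X h" by (auto simp: pullback_space_def)
  have "tuple_pow n U' m (Y y) = Y (tuple_pow n U m y)"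
    using assms(1) by (intro tuple_pow_intertwine[symmetric]) (auto simp: intertwiners_def)
  with eq assms(2) show ?thesis unfolding transfer_rel_def by auto
qed

lemma intertwiner_bound:
  assumes "Y \<in> intertwiners n U U'" "X' = Y \<circ> X"
  shows "norm (Y y) \<le> C * norm y"
proof (rule norm_bound_on_dense[OF dense])
  show "continuous_on UNIV Y"
    using assms(1) by (simp add: intertwiners_def bounded_clinear_continuous_on)
qed (rule R_bound[OF R_intertwiner[OF assms]])

lemma intertwiner_unique:
  assumes "Y \<in> intertwiners n U U'" "X' = Y \<circ> X" "Z \<in> intertwiners n U U'" "X' = Z \<circ> X"
  shows "Y = Z"
proof
  show "Y y = Z y" for y
  proof (rule continuous_eq_on_dense[OF dense])
    show "Y v = Z v" if "v \<in> D" for v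
      using R_unique R_intertwiner assms that by blast
  qed (use assms(1,3) in \<open>simp_all add: intertwiners_def bounded_clinear_continuous_on\<close>)
qed

lemma intertwiner_exists:
  obtains Y where "Y \<in> intertwiners n U U'" "X' = Y \<circ> X"
proof -
  have "\<forall>y\<in>D. \<exists>z. R y z" using R_exists by blast
  then obtain f where f: "\<And>y. y \<in> D \<Longrightarrow> R y (f y)"
    unfolding bchoice_iff by blast
  \<comment> \<open>Since the choice of \<open>f\<close> is forced, each closure property of
    \<open>R\<close> becomes an identity for \<open>f\<close>.\<close>
  have f_eq: "f y = z" if "R y z" for y z
    using f[OF R_imp_D[OF that]] that by (rule R_unique)
  obtain Y where Y: "bounded_clinear Y" "\<And>y. y \<in> D \<Longrightarrow> Y y = f y"
  proof (rule bounded_clinear_extension[OF dense, of f C])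
    fix x y c assume "x \<in> D" "y \<in> D"
    then show "x + y \<in> D" "f (x + y) = f x + f y"
      using R_add f R_imp_D f_eq by blast+
  next
    fix x c assume "x \<in> D"
    then show "scaleC c x \<in> D" "f (scaleC c x) = scaleC c (f x)" "norm (f x) \<le> C * norm x"
      using R_scaleC f R_imp_D f_eq R_bound by blast+
  qed blast
  have Y_eq: "Y y = z" if "R y z" for y z
    using Y(2)[OF R_imp_D[OF that]] f_eq[OF that] by simp
  \<comment> \<open>On \<open>D\<close> this is \<open>R_U\<close>; both sides are continuous, so it
    extends to the whole space.\<close>
  have "Y (U i y) = U' i (Y y)" if i: "i \<in> {1..n}" for i y
  proof (rule continuous_eq_on_dense[OF dense, where x = y])
    have "bounded_clinear (U i)" "bounded_clinear (U' i)"
      using U(2)[OF i] U'(2)[OF i] by (simp_all add: unitary_operator_def)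
    with Y(1) have "bounded_clinear (Y \<circ> U i)" "bounded_clinear (U' i \<circ> Y)"
      by (simp_all add: bounded_clinear_comp)
    from this[THEN bounded_clinear_continuous_on]
    show "continuous_on UNIV (\<lambda>y. Y (U i y))" "continuous_on UNIV (\<lambda>y. U' i (Y y))"
      by (simp_all add: o_def)
    show "Y (U i v) = U' i (Y v)" if "v \<in> D" for v
      using f[OF that] R_U[OF _ i] Y_eq by metis
  qed
  with Y(1) have "Y \<in> intertwiners n U U'" by (auto simp: intertwiners_def)
  moreover have "X' = Y \<circ> X" using Y_eq[OF R_X] by auto
  ultimately show thesis by (rule that)
qed

end

section \<open>Estimates from orbits and the Lower Orbit Condition\<close>

lemma norm_le_onorm_orbit_inf:
  assumes "unitary_intertwining_pair n T X U"
  shows "norm (X h) \<le> onorm X * orbit_inf n T h"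
proof -
  have X: "bounded_linear X"
    using unitary_intertwining_pairD(3)[OF assms] by (simp add: bounded_clinear_def)
  have le: "norm (X h) \<le> onorm X * norm (tuple_pow n T k h)" for k
    using onorm[OF X, of "tuple_pow n T k h"]
    by (simp add: unitary_intertwining_pair_tuple_pow[OF assms] unitary_intertwining_pair_norm[OF assms])
  show ?thesis
  \<comment> \<open>The infimum is reached by dividing \<open>le\<close> by \<open>onorm X\<close>;
    when that norm is zero, \<open>le\<close> already gives \<open>X h = 0\<close>.\<close>
  proof (cases "onorm X = 0")
    case True
    with le show ?thesis by simp
  next
    case False
    then have pos: "onorm X > 0" using onorm_pos_le[OF X] by simp
    have "norm (X h) / onorm X \<le> orbit_inf n T h"
      unfolding orbit_inf_def
      by (rule cINF_greatest) (use le pos in \<open>auto simp: field_simps\<close>)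
    with pos show ?thesis by (simp add: field_simps)
  qed
qed

lemma dominated_pair_lower_orbit_condition:
  assumes "commuting_tuple n T" "unitary_intertwining_pair n T X U" "minimal_pair n X U"
    and "lower_orbit_condition n T X \<kappa>" "unitary_intertwining_pair n T X' U'"
  shows "dominated_pair n T X U X' U' (\<kappa> * onorm X')"
proof
  fix h
  have "norm (X' h) \<le> onorm X' * orbit_inf n T h"
    by (rule norm_le_onorm_orbit_inf[OF assms(5)])
  also have "\<dots> \<le> onorm X' * (\<kappa> * norm (X h))"
    using assms(4) unitary_intertwining_pairD(3)[OF assms(5)]
    by (intro mult_left_mono) (auto simp: lower_orbit_condition_def bounded_clinear_def onorm_pos_le)
  finally show "norm (X' h) \<le> \<kappa> * onorm X' * norm (X h)" by (simp add: mult_ac)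
qed (use assms in auto)

theorem proposition15:
  fixes T :: "nat \<Rightarrow> 'h :: complex_hilbert \<Rightarrow> 'h"
    and U :: "nat \<Rightarrow> 'k :: complex_hilbert \<Rightarrow> 'k"
    and X :: "'h \<Rightarrow> 'k"
    and n :: nat and \<kappa> :: real
  assumes "1 \<le> n"
    and "separable_space (euclidean :: 'h topology)"
    and "commuting_tuple n T"
    and "unitary_intertwining_pair n T X U"
    and "minimal_pair n X U"
    and "lower_orbit_condition n T X \<kappa>"
  shows "unitary_asymptote TYPE('c :: complex_hilbert) n T X U \<and>
    norm_control TYPE('d :: complex_hilbert) n X U \<kappa>"
proof
  \<comment> \<open>The space of the competing pair is still schematic here, so the fact serves both
    \<open>'c\<close> and \<open>'d\<close>.\<close>
  note dominated = dominated_pair_lower_orbit_condition[OF assms(3-6)]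
  show "unitary_asymptote TYPE('c) n T X U"
    unfolding unitary_asymptote_def
  proof (intro conjI allI impI)
    fix X' :: "'h \<Rightarrow> 'c" and U'
    assume pair': "unitary_intertwining_pair n T X' U'"
    show "\<exists>!Y'. Y' \<in> intertwiners n U U' \<and> X' = Y' \<circ> X"
      using dominated_pair.intertwiner_exists[OF dominated[OF pair']]
        dominated_pair.intertwiner_unique[OF dominated[OF pair']] by metis
  qed (fact assms(4))
  show "norm_control TYPE('d) n X U \<kappa>"
    unfolding norm_control_def
  proof (intro conjI allI impI)
    show "0 \<le> \<kappa>" using assms(6) by (simp add: lower_orbit_condition_def)
  next
    fix Y' :: "'k \<Rightarrow> 'd" and U'
    assume Y': "unitary_intertwining_pair n U Y' U'"
    \<comment> \<open>\<open>Y'\<close> is itself a solution of the factorization problem for the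
      pair \<open>(Y' \<circ> X, U')\<close> of \<open>T\<close>, so the bound for intertwiners
      applies to it.\<close>
    have "norm (Y' y) \<le> \<kappa> * onorm (Y' \<circ> X) * norm y" for y
      using Y' by (intro dominated_pair.intertwiner_bound[OF
            dominated[OF unitary_intertwining_pair_comp[OF assms(4) Y']]])
        (simp_all add: unitary_intertwining_pair_def)
    \<comment> \<open>\<open>onorm_bound\<close> needs a nonnegative constant, which the pointwise
      bound does not supply on the zero space.\<close>
    moreover have "0 \<le> \<kappa> * onorm (Y' \<circ> X)"
      using assms(6) unitary_intertwining_pairD(3)[OF unitary_intertwining_pair_comp[OF assms(4) Y']]
      by (auto simp only: lower_orbit_condition_def bounded_clinear_def onorm_pos_le zero_le_mult_iff)
    ultimately show "onorm Y' \<le> \<kappa> * onorm (Y' \<circ> X)"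
      by (intro onorm_bound)
  qed
qed

end
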